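(* Let $c\ge1$, $n\ge0$ be integers, let $n_0,\ldots,n_c$ be non-negative integers with $n_0+\cdots+n_c=n$, and let $d\in P_{n,c}$. For $i\in\{1,\ldots,c\}$ let $\ell_i$ be the number of vertical edges of $d$ colored $u_i$ (an edge is vertical if it joins bottom vertex $k$ to top vertex $k$ for some $k$). Then the value of the irreducible character at $d$ is $$\chi^n_{n_0,\ldots,n_c}(d)=\begin{cases}\prod_{i=1}^c\binom{\ell_i}{n_i}&\text{if } n_i\le\ell_i\text{ for all } i\in\{1,\ldots,c\},\\ 0&\text{otherwise.}\end{cases}$$
   Context: Fix colors $u_1,\ldots,u_c$. For $n\ge1$, $P_{n,c}$ is the set of diagrams consisting of a top row and a bottom row of $n$ vertices (each row numbered $1,\ldots,n$) together with edges, each joining a top vertex to a bottom vertex and colored with one of the $c$ colors, such that each vertex is incident to at most one edge and no two edges of the same color cross (if top $i$–bottom $j$ and top $i'$–bottom $j'$ are edges of the same color with $i<i'$, then $j<j'$). $P_{0,c}=\{\emptyset\}$ consists of the single empty diagram. The product $d_1d_2$ is obtained by stacking $d_1$ on top of $d_2$, identifying the bottom vertices of $d_1$ with the top vertices of $d_2$; the edges of $d_1d_2$ are exactly the monochromatic paths from the top of $d_1$ to the bottom of $d_2$ (with that color). This makes $P_{n,c}$ a semigroup. $\mathbb{C}P_{n,c}$ is the $\mathbb{C}$-algebra with basis $P_{n,c}$ and multiplication extended bilinearly; it is associative and unital. For $d\in P_{n,c}$, $\mathrm{size}(d)$ is the number of edges of $d$. Write $d'\subseteq d$ if every edge of $d'$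 is an edge of $d$ with the same color. Set $x_d=\sum_{d'\subseteq d}(-1)^{\mathrm{size}(d)-\mathrm{size}(d')}d'$. Let $\beta(d)=(\beta_0(d),\ldots,\beta_c(d))$, where $\beta_0(d)$ is the set of isolated bottom vertices and, for $1\le i\le c$, $\beta_i(d)$ is the set of bottom vertices incident to an edge colored $u_i$. Let $X_n=\{\beta(d)\mid d\in P_{n,c}\}$, and write $T=(T_0,\ldots,T_c)$ for $T\in X_n$. For $T\in X_n$ let $W^n_T=\mathbb{C}\text{-span}\{x_a\mid a\in P_{n,c},\ \beta(a)=T\}$, a $\mathbb{C}P_{n,c}$-module under left multiplication. The modules $W^n_T$ with the same values $|T_0|,\dots,|T_c|$ are isomorphic, and $W^n_{n_0,\ldots,n_c}$ denotes a representative of the isomorphism class of the $W^n_T$ with $|T_i|=n_i$ for all $i\in\{0,\ldots,c\}$. The character $\chi^n_{n_0,\ldots,n_c}(d)$ is the trace of $d\in P_{n,c}$ as a linear operator on $W^n_{n_0,\ldots,n_c}$. *)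

theory Defs
  imports Complex_Main "HOL-Library.Poly_Mapping"
begin

section \<open>Colored planar rook diagrams\<close>

text \<open>
  An edge is a triple (top vertex, bottom vertex, color); the colors
  \<open>u\<^sub>1, \<dots>, u\<^sub>c\<close> are the numbers \<open>1, \<dots>, c\<close>.
\<close>

type_synonym diagram = "(nat \<times> nat \<times> nat) set"

definition diagrams :: "nat \<Rightarrow> nat \<Rightarrow> diagram set" where
  "diagrams n c = {d. d \<subseteq> {1..n} \<times> {1..n} \<times> {1..c}
     \<and> (\<forall>e\<in>d. \<forall>e'\<in>d. fst e = fst e' \<longrightarrow> e = e')
     \<and> (\<forall>e\<in>d. \<forall>e'\<in>d. fst (snd e) = fst (snd e') \<longrightarrow> e = e')
     \<and> (\<forall>i j i' j' u. (i, j, u) \<in> d \<longrightarrow> (i', j', u) \<in> d \<longrightarrow> i < i' \<longrightarrow> j < j')}"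

definition diagram_mult :: "diagram \<Rightarrow> diagram \<Rightarrow> diagram" where
  "diagram_mult d\<^sub>1 d\<^sub>2 = {(i, k, u) | i k u. \<exists>j. (i, j, u) \<in> d\<^sub>1 \<and> (j, k, u) \<in> d\<^sub>2}"

text \<open>\<open>bottom_type n d\<close> is the tuple \<open>\<beta>(d)\<close>; for \<open>d\<close> with colors in \<open>{1..c}\<close> its entries with
  index greater than \<open>c\<close> are empty.\<close>

definition bottom_type :: "nat \<Rightarrow> diagram \<Rightarrow> nat \<Rightarrow> nat set" where
  "bottom_type n d i =
     (if i = 0 then {j \<in> {1..n}. \<nexists>k u. (k, j, u) \<in> d} else {j. \<exists>k. (k, j, i) \<in> d})"

definition bottom_types :: "nat \<Rightarrow> nat \<Rightarrow> (nat \<Rightarrow> nat set) set" where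
  "bottom_types n c = bottom_type n ` diagrams n c"

definition vertical_edges :: "diagram \<Rightarrow> nat \<Rightarrow> nat" where
  "vertical_edges d i = card {k. (k, k, i) \<in> d}"


section \<open>The diagram algebra\<close>

text \<open>
  Formal complex combinations of diagrams.  The algebra \<open>\<complex>P\<^bsub>n,c\<^esub>\<close> consists of those
  supported on \<open>diagrams n c\<close>, with the restriction of \<open>alg_mult\<close> as its product.
\<close>

definition scale :: "complex \<Rightarrow> (diagram \<Rightarrow>\<^sub>0 complex) \<Rightarrow> (diagram \<Rightarrow>\<^sub>0 complex)" where
  "scale a v = Poly_Mapping.map ((*) a) v"

lemma lookup_scale: "Poly_Mapping.lookup (scale a v) d = a * Poly_Mapping.lookup v d"
  by (simp add: scale_def Poly_Mapping.map.rep_eq when_def)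

global_interpretation cvs: vector_space scale
  by unfold_locales (auto intro!: poly_mapping_eqI simp: lookup_scale lookup_add algebra_simps)

definition basis_elem :: "diagram \<Rightarrow> (diagram \<Rightarrow>\<^sub>0 complex)" where
  "basis_elem d = Poly_Mapping.single d 1"

definition alg_mult ::
    "(diagram \<Rightarrow>\<^sub>0 complex) \<Rightarrow> (diagram \<Rightarrow>\<^sub>0 complex) \<Rightarrow> (diagram \<Rightarrow>\<^sub>0 complex)" where
  "alg_mult v w = (\<Sum>d\<^sub>1\<in>Poly_Mapping.keys v. \<Sum>d\<^sub>2\<in>Poly_Mapping.keys w.
     scale (Poly_Mapping.lookup v d\<^sub>1 * Poly_Mapping.lookup w d\<^sub>2) (basis_elem (diagram_mult d\<^sub>1 d\<^sub>2)))"

definition x_elem :: "diagram \<Rightarrow> (diagram \<Rightarrow>\<^sub>0 complex)" where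
  "x_elem d = (\<Sum>d'\<in>Pow d. scale ((-1) ^ (card d - card d')) (basis_elem d'))"


section \<open>The modules and their characters\<close>

definition W :: "nat \<Rightarrow> nat \<Rightarrow> (nat \<Rightarrow> nat set) \<Rightarrow> (diagram \<Rightarrow>\<^sub>0 complex) set" where
  "W n c T = cvs.span {x_elem a | a. a \<in> diagrams n c \<and> bottom_type n a = T}"

text \<open>
  The trace of an operator \<open>f\<close> that maps the finite-dimensional subspace \<open>V\<close> linearly into
  itself: the sum of the diagonal entries of its matrix with respect to some basis of \<open>V\<close>.
\<close>

definition trace_on ::
    "(diagram \<Rightarrow>\<^sub>0 complex) set \<Rightarrow> ((diagram \<Rightarrow>\<^sub>0 complex) \<Rightarrow> (diagram \<Rightarrow>\<^sub>0 complex)) \<Rightarrow> complex" where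
  "trace_on V f = (let B = (SOME B. cvs.independent B \<and> cvs.span B = V)
     in \<Sum>b\<in>B. cvs.representation B (f b) b)"

text \<open>
  The modules \<open>W n c T\<close> with prescribed cardinalities \<open>|T\<^sub>i| = ns i\<close> for \<open>i \<le> c\<close> are isomorphic;
  the choice operator picks a representative.
\<close>

definition W_rep :: "nat \<Rightarrow> nat \<Rightarrow> (nat \<Rightarrow> nat) \<Rightarrow> (diagram \<Rightarrow>\<^sub>0 complex) set" where
  "W_rep n c ns = W n c (SOME T. T \<in> bottom_types n c \<and> (\<forall>i\<le>c. card (T i) = ns i))"

definition chi :: "nat \<Rightarrow> nat \<Rightarrow> (nat \<Rightarrow> nat) \<Rightarrow> diagram \<Rightarrow> complex" where
  "chi n c ns d = trace_on (W_rep n c ns) (alg_mult (basis_elem d))"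

end

theory Submission
  imports Defs "HOL-Library.FuncSet" "HOL-Library.Infinite_Set"
begin

text \<open>
  The product \<open>d x\<^sub>a\<close> is \<open>x\<^bsub>da\<^esub>\<close> if every edge of \<open>a\<close> is continued by an edge of \<open>d\<close> of the same
  color; otherwise deleting an edge of \<open>a\<close> that is not continued pairs off the terms of the
  alternating sum, and \<open>d x\<^sub>a = 0\<close>.  So \<open>d\<close> maps the basis of the \<open>x\<^sub>a\<close> with \<open>\<beta>(a) = T\<close> to itself
  and \<open>0\<close>, and its trace counts the \<open>a\<close> that it fixes.  These are the \<open>a\<close> whose every edge hangs
  from a vertical edge of \<open>d\<close> of the same color.  By planarity such an \<open>a\<close> is determined by its
  top vertices of each color, which may be any \<open>n\<^sub>i\<close> of the \<open>\<ell>\<^sub>i\<close> vertical positions.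
\<close>

section \<open>The trace\<close>

text \<open>The matrices of \<open>f\<close> in two bases are conjugate, so they have the same
  trace. \<open>B\<close> and \<open>B'\<close> are finite bases of the same subspace, which
  \<open>f\<close> need only map into itself.\<close>

lemma (in vector_space) sum_representation_independent:
  assumes B: "independent B" "finite B" and B': "independent B'" "finite B'"
    and span: "span B = span B'"
    and lin: "Vector_Spaces.linear scale scale f"
    and maps: "\<And>b. b \<in> B' \<Longrightarrow> f b \<in> span B'"
  shows "(\<Sum>b\<in>B. representation B (f b) b) = (\<Sum>b\<in>B'. representation B' (f b) b)"
proof -
  interpret f: Vector_Spaces.linear scale scale f by (rule lin)
  have in_span: "b \<in> span B'" if "b \<in> B" for b
    using that span span_base by blast
  have in_span': "b \<in> span B" if "b \<in> B'" for b
    using that span span_base by blast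
  have f_span: "f b \<in> span B" if "b \<in> B'" for b
    using that maps span by blast
  \<comment> \<open>A diagonal entry in \<open>B\<close>, written with the matrix of
    \<open>f\<close> in \<open>B'\<close> and the two change-of-basis matrices.\<close>
  have diag: "representation B (f b) b =
      (\<Sum>b'\<in>B'. \<Sum>b''\<in>B'. representation B' (f b') b'' * (representation B b'' b * representation B' b b'))"
    if b: "b \<in> B" for b
  proof -
    have "f b = f (\<Sum>b'\<in>B'. scale (representation B' b b') b')"
      using sum_representation_eq[OF B'(1) in_span[OF b] B'(2) subset_refl] by simp
    also have "\<dots> = (\<Sum>b'\<in>B'. scale (representation B' b b') (f b'))"
      by (simp add: f.sum f.scale)
    finally have 1: "representation B (f b) b
        = (\<Sum>b'\<in>B'. representation B' b b' * representation B (f b') b)"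
      using f_span by (simp add: representation_sum representation_scale B span_scale)
    have 2: "representation B (f b') b
        = (\<Sum>b''\<in>B'. representation B' (f b') b'' * representation B b'' b)" if b': "b' \<in> B'" for b'
    proof -
      have "f b' = (\<Sum>b''\<in>B'. scale (representation B' (f b') b'') b'')"
        using sum_representation_eq[OF B'(1) maps[OF b'] B'(2) subset_refl] by simp
      then have "representation B (f b') b
          = representation B (\<Sum>b''\<in>B'. scale (representation B' (f b') b'') b'') b"
        by simp
      also have "\<dots> = (\<Sum>b''\<in>B'. representation B' (f b') b'' * representation B b'' b)"
        using in_span' by (simp add: representation_sum representation_scale B span_scale)
      finally show ?thesis .
    qed
    show ?thesis
      unfolding 1 by (intro sum.cong) (simp_all add: 2 sum_distrib_left mult_ac)
  qed
  \<comment> \<open>The change-of-basis matrices are inverse to each other; moving the sum over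
    \<open>B\<close> innermost makes this applicable.\<close>
  have collapse: "(\<Sum>b\<in>B. representation B b'' b * representation B' b b') = (if b'' = b' then 1 else 0)"
    if b'': "b'' \<in> B'" for b' b''
  proof -
    have "b'' = (\<Sum>b\<in>B. scale (representation B b'' b) b)"
      using sum_representation_eq[OF B(1) in_span'[OF b''] B(2) subset_refl] by simp
    then have "representation B' b'' b' = representation B' (\<Sum>b\<in>B. scale (representation B b'' b) b) b'"
      by simp
    also have "\<dots> = (\<Sum>b\<in>B. representation B b'' b * representation B' b b')"
      using in_span by (simp add: representation_sum representation_scale B' span_scale)
    finally show ?thesis
      using representation_basis[OF B'(1) b''] by auto
  qed
  have "(\<Sum>b\<in>B. representation B (f b) b)
      = (\<Sum>b\<in>B. \<Sum>b'\<in>B'. \<Sum>b''\<in>B'. representation B' (f b') b'' * (representation B b'' b * representation B' b b'))"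
    by (intro sum.cong refl diag)
  also have "\<dots> = (\<Sum>b'\<in>B'. \<Sum>b\<in>B. \<Sum>b''\<in>B'. representation B' (f b') b'' * (representation B b'' b * representation B' b b'))"
    by (rule sum.swap)
  also have "\<dots> = (\<Sum>b'\<in>B'. \<Sum>b''\<in>B'. \<Sum>b\<in>B. representation B' (f b') b'' * (representation B b'' b * representation B' b b'))"
    by (intro sum.cong refl sum.swap)
  also have "\<dots> = (\<Sum>b'\<in>B'. \<Sum>b''\<in>B'. representation B' (f b') b'' * (if b'' = b' then 1 else 0))"
    by (intro sum.cong refl) (simp add: collapse flip: sum_distrib_left)
  also have "\<dots> = (\<Sum>b'\<in>B'. representation B' (f b') b')"
    by (intro sum.cong refl) (simp add: B' if_distrib cong: if_cong)
  finally show ?thesis .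
qed

text \<open>Frees the trace from the arbitrary basis picked by the choice operator, so that it can
  be read off the \<open>x_elem\<close> basis.\<close>

lemma trace_on_basis:
  assumes B: "cvs.independent B" "finite B"
    and lin: "Vector_Spaces.linear scale scale f"
    and maps: "\<And>b. b \<in> B \<Longrightarrow> f b \<in> cvs.span B"
  shows "trace_on (cvs.span B) f = (\<Sum>b\<in>B. cvs.representation B (f b) b)"
proof -
  define C where "C = (SOME C. cvs.independent C \<and> cvs.span C = cvs.span B)"
  have C: "cvs.independent C \<and> cvs.span C = cvs.span B"
    unfolding C_def by (rule someI[of _ B]) (simp add: B)
  \<comment> \<open>An independent set inside the span of a finite set is finite, so the chosen
    basis yields a genuine sum.\<close>
  then have "finite C"
    using cvs.independent_span_bound[OF B(2), of C] cvs.span_superset[of C] by auto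
  then show ?thesis
    unfolding trace_on_def C_def[symmetric] Let_def
    using cvs.sum_representation_independent[OF _ _ B _ lin maps] C by blast
qed


section \<open>The elements \<open>x\<^sub>d\<close>\<close>

lemma lookup_basis_elem: "Poly_Mapping.lookup (basis_elem d) e = (if e = d then 1 else 0)"
  by (simp add: basis_elem_def lookup_single when_def)

lemma lookup_x_elem:
  assumes "finite d"
  shows "Poly_Mapping.lookup (x_elem d) e = (if e \<subseteq> d then (-1) ^ (card d - card e) else 0)"
  using assms
  by (simp add: x_elem_def lookup_sum lookup_scale lookup_basis_elem if_distrib cong: if_cong)

text \<open>The coefficient at \<open>a\<close> is 1 in \<open>x_elem a\<close> and vanishes in
  \<open>x_elem b\<close> unless \<open>a \<subseteq> b\<close>; antisymmetry of inclusion
  finishes.\<close>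

lemma inj_on_x_elem:
  assumes "\<And>a. a \<in> A \<Longrightarrow> finite a"
  shows "inj_on x_elem A"
proof (rule inj_onI)
  have *: "a \<subseteq> b" if "a \<in> A" "b \<in> A" "x_elem a = x_elem b" for a b
  proof (rule ccontr)
    assume "\<not> a \<subseteq> b"
    then have "Poly_Mapping.lookup (x_elem b) a = 0"
      using assms that by (simp add: lookup_x_elem)
    moreover have "Poly_Mapping.lookup (x_elem a) a = 1"
      using assms[OF that(1)] by (simp add: lookup_x_elem)
    ultimately show False using that(3) by simp
  qed
  fix a b assume "a \<in> A" "b \<in> A" "x_elem a = x_elem b"
  with *[of a b] *[of b a] show "a = b" by auto
qed

text \<open>The transition from diagrams to the \<open>x_elem\<close> is unitriangular with respect
  to inclusion.\<close>

lemma independent_x_elem: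
  assumes A: "finite A" "\<And>a. a \<in> A \<Longrightarrow> finite a"
  shows "cvs.independent (x_elem ` A)"
proof (rule cvs.independent_if_scalars_zero)
  fix u v
  assume sum0: "(\<Sum>x\<in>x_elem ` A. scale (u x) x) = 0" and v: "v \<in> x_elem ` A"
  have eq0: "(\<Sum>a\<in>A. scale (u (x_elem a)) (x_elem a)) = 0"
    using sum0 sum.reindex[OF inj_on_x_elem[OF A(2)], where g = "\<lambda>x. scale (u x) x"] by (simp add: o_def)
  have "\<forall>a\<in>A. u (x_elem a) = 0"
  proof (rule ccontr)
    \<comment> \<open>At an inclusion-maximal \<open>m\<close> of the support \<open>N\<close>, only
      \<open>x_elem m\<close> contributes to the coefficient of \<open>m\<close>: any other
      \<open>a\<close> either does not contain \<open>m\<close> or has scalar 0.\<close>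
    define N where "N = {a \<in> A. u (x_elem a) \<noteq> 0}"
    assume "\<not> (\<forall>a\<in>A. u (x_elem a) = 0)"
    then have "N \<noteq> {}" "finite N" using A by (auto simp: N_def)
    then obtain m where m: "m \<in> N" and max: "\<forall>a\<in>N. m \<le> a \<longrightarrow> m = a"
      using finite_has_maximal[of N] by blast
    then have mA: "m \<in> A" and um: "u (x_elem m) \<noteq> 0" by (auto simp: N_def)
    have "0 = (\<Sum>a\<in>A. u (x_elem a) * Poly_Mapping.lookup (x_elem a) m)"
      using arg_cong[OF eq0, of "\<lambda>v. Poly_Mapping.lookup v m"]
      by (simp add: lookup_sum lookup_scale)
    also have "\<dots> = (\<Sum>a\<in>A. if a = m then u (x_elem m) else 0)"
      using max A mA by (intro sum.cong refl) (auto simp: lookup_x_elem N_def)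
    also have "\<dots> = u (x_elem m)" using A mA by simp
    finally show False using um by simp
  qed
  then show "u v = 0" using v by auto
qed (use A in simp)


section \<open>Left multiplication\<close>

text \<open>Summing over any finite superset of the support lets products of different vectors share
  one index set; the support of \<open>v + w\<close> may shrink by cancellation.\<close>

lemma alg_mult_basis_elem:
  assumes "finite A" "Poly_Mapping.keys v \<subseteq> A"
  shows "alg_mult (basis_elem d) v
    = (\<Sum>e\<in>A. scale (Poly_Mapping.lookup v e) (basis_elem (diagram_mult d e)))"
proof -
  have "alg_mult (basis_elem d) v
      = (\<Sum>e\<in>Poly_Mapping.keys v. scale (Poly_Mapping.lookup v e) (basis_elem (diagram_mult d e)))"
    by (simp add: alg_mult_def basis_elem_def)
  also have "\<dots> = (\<Sum>e\<in>A. scale (Poly_Mapping.lookup v e) (basis_elem (diagram_mult d e)))"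
    using assms by (intro sum.mono_neutral_left) (auto simp: in_keys_iff)
  finally show ?thesis .
qed

lemma linear_alg_mult_basis_elem: "Vector_Spaces.linear scale scale (alg_mult (basis_elem d))"
proof (unfold_locales)
  fix v w :: "diagram \<Rightarrow>\<^sub>0 complex" and a :: complex
  let ?A = "Poly_Mapping.keys v \<union> Poly_Mapping.keys w"
  have "Poly_Mapping.keys (v + w) \<subseteq> ?A" by (rule keys_add)
  then show "alg_mult (basis_elem d) (v + w) = alg_mult (basis_elem d) v + alg_mult (basis_elem d) w"
    by (simp add: alg_mult_basis_elem[of ?A] lookup_add cvs.scale_left_distrib sum.distrib)
  have "Poly_Mapping.keys (scale a v) \<subseteq> Poly_Mapping.keys v"
    by (auto simp: in_keys_iff lookup_scale)
  then show "alg_mult (basis_elem d) (scale a v) = scale a (alg_mult (basis_elem d) v)"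
    by (simp add: alg_mult_basis_elem[of "Poly_Mapping.keys v"] lookup_scale cvs.scale_sum_right)
qed

lemma alg_mult_basis_elem_x_elem:
  assumes "finite a"
  shows "alg_mult (basis_elem d) (x_elem a)
    = (\<Sum>a'\<in>Pow a. scale ((-1) ^ (card a - card a')) (basis_elem (diagram_mult d a')))"
proof -
  have "Poly_Mapping.keys (x_elem a) \<subseteq> Pow a"
    using assms by (auto simp: in_keys_iff lookup_x_elem split: if_splits)
  then show ?thesis
    using assms by (subst alg_mult_basis_elem[of "Pow a"]) (auto simp: lookup_x_elem)
qed

section \<open>Diagrams in coordinates: finiteness, products and bottom vertices\<close>

lemma diagramsD:
  assumes "d \<in> diagrams n c"
  shows diagrams_range: "(i, j, u) \<in> d \<Longrightarrow> i \<in> {1..n} \<and> j \<in> {1..n} \<and> u \<in> {1..c}"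
    and diagrams_top: "(i, j, u) \<in> d \<Longrightarrow> (i, j', u') \<in> d \<Longrightarrow> j = j' \<and> u = u'"
    and diagrams_bottom: "(i, j, u) \<in> d \<Longrightarrow> (i', j, u') \<in> d \<Longrightarrow> i = i' \<and> u = u'"
    and diagrams_planar: "(i, j, u) \<in> d \<Longrightarrow> (i', j', u) \<in> d \<Longrightarrow> i < i' \<longleftrightarrow> j < j'"
proof -
  have unfolded: "d \<subseteq> {1..n} \<times> {1..n} \<times> {1..c}"
    "\<forall>e\<in>d. \<forall>e'\<in>d. fst e = fst e' \<longrightarrow> e = e'"
    "\<forall>e\<in>d. \<forall>e'\<in>d. fst (snd e) = fst (snd e') \<longrightarrow> e = e'"
    "\<forall>i j i' j' u. (i, j, u) \<in> d \<longrightarrow> (i', j', u) \<in> d \<longrightarrow> i < i' \<longrightarrow> j < j'"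
    using assms unfolding diagrams_def by blast+
  show "(i, j, u) \<in> d \<Longrightarrow> i \<in> {1..n} \<and> j \<in> {1..n} \<and> u \<in> {1..c}"
    using unfolded(1) by blast
  show "(i, j, u) \<in> d \<Longrightarrow> (i, j', u') \<in> d \<Longrightarrow> j = j' \<and> u = u'"
    using unfolded(2) by fastforce
  show bot: "(i, j, u) \<in> d \<Longrightarrow> (i', j, u') \<in> d \<Longrightarrow> i = i' \<and> u = u'" for i j u i' u'
    using unfolded(3) by fastforce
  \<comment> \<open>The converse direction holds because equal top vertices force equal bottom
    vertices, and \<open>i' < i\<close> would give \<open>j' < j\<close>.\<close>
  show "i < i' \<longleftrightarrow> j < j'" if "(i, j, u) \<in> d" "(i', j', u) \<in> d"
    using that unfolded(2,4) by (metis fst_conv less_asym linorder_less_linear snd_conv)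
qed

lemma diagramsI:
  assumes "\<And>i j u. (i, j, u) \<in> d \<Longrightarrow> i \<in> {1..n} \<and> j \<in> {1..n} \<and> u \<in> {1..c}"
    and "\<And>i j u j' u'. (i, j, u) \<in> d \<Longrightarrow> (i, j', u') \<in> d \<Longrightarrow> j = j' \<and> u = u'"
    and "\<And>i j u i' u'. (i, j, u) \<in> d \<Longrightarrow> (i', j, u') \<in> d \<Longrightarrow> i = i' \<and> u = u'"
    and "\<And>i j u i' j'. (i, j, u) \<in> d \<Longrightarrow> (i', j', u) \<in> d \<Longrightarrow> i < i' \<Longrightarrow> j < j'"
  shows "d \<in> diagrams n c"
proof -
  have "d \<subseteq> {1..n} \<times> {1..n} \<times> {1..c}" using assms(1) by auto
  moreover have "\<forall>e\<in>d. \<forall>e'\<in>d. fst e = fst e' \<longrightarrow> e = e'" using assms(2) by fastforce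
  moreover have "\<forall>e\<in>d. \<forall>e'\<in>d. fst (snd e) = fst (snd e') \<longrightarrow> e = e'" using assms(3) by fastforce
  moreover have "\<forall>i j i' j' u. (i, j, u) \<in> d \<longrightarrow> (i', j', u) \<in> d \<longrightarrow> i < i' \<longrightarrow> j < j'"
    using assms(4) by blast
  ultimately show ?thesis unfolding diagrams_def by blast
qed

lemma finite_diagrams: "finite (diagrams n c)"
  by (rule finite_subset[of _ "Pow ({1..n} \<times> {1..n} \<times> {1..c})"]) (auto simp: diagrams_def)

lemma finite_diagram: "d \<in> diagrams n c \<Longrightarrow> finite d"
  by (rule finite_subset[of _ "{1..n} \<times> {1..n} \<times> {1..c}"]) (auto simp: diagrams_def)

lemma mem_diagram_mult:
  "(i, k, u) \<in> diagram_mult d e \<longleftrightarrow> (\<exists>j. (i, j, u) \<in> d \<and> (j, k, u) \<in> e)"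
  by (auto simp: diagram_mult_def)

lemma diagram_mult_closed:
  assumes d: "d \<in> diagrams n c" and e: "e \<in> diagrams n c"
  shows "diagram_mult d e \<in> diagrams n c"
proof (rule diagramsI)
  show "i \<in> {1..n} \<and> j \<in> {1..n} \<and> u \<in> {1..c}" if "(i, j, u) \<in> diagram_mult d e" for i j u
    using that diagrams_range[OF d] diagrams_range[OF e] unfolding mem_diagram_mult by blast
  show "j = j' \<and> u = u'" if "(i, j, u) \<in> diagram_mult d e" "(i, j', u') \<in> diagram_mult d e"
    for i j u j' u'
    using that diagrams_top[OF d] diagrams_top[OF e] unfolding mem_diagram_mult by metis
  show "i = i' \<and> u = u'" if "(i, j, u) \<in> diagram_mult d e" "(i', j, u') \<in> diagram_mult d e"
    for i j u i' u'
    using that diagrams_bottom[OF d] diagrams_bottom[OF e] unfolding mem_diagram_mult by metis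
  show "j < j'" if "(i, j, u) \<in> diagram_mult d e" "(i', j', u) \<in> diagram_mult d e" "i < i'"
    for i j u i' j'
    using that diagrams_planar[OF d] diagrams_planar[OF e] unfolding mem_diagram_mult by metis
qed

text \<open>The condition under which no edge of \<open>a\<close> is lost when \<open>d\<close> is
  stacked on top; it separates the two cases of the left action.\<close>

definition extends :: "diagram \<Rightarrow> diagram \<Rightarrow> bool" where
  "extends d a \<longleftrightarrow> (\<forall>(j, k, u)\<in>a. \<exists>i. (i, j, u) \<in> d)"

lemma bottom_type_cong:
  assumes "\<And>j u. (\<exists>k. (k, j, u) \<in> a) \<longleftrightarrow> (\<exists>k. (k, j, u) \<in> b)"
  shows "bottom_type n a = bottom_type n b"
proof -
  have "(\<nexists>k u. (k, j, u) \<in> a) \<longleftrightarrow> (\<nexists>k u. (k, j, u) \<in> b)" for j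
    using assms by blast
  then show ?thesis
    unfolding bottom_type_def by (intro ext) (simp add: assms)
qed

text \<open>When no edge is lost, stacking \<open>d\<close> on top moves only the top ends of the
  edges of \<open>a\<close>.\<close>

lemma bottom_type_diagram_mult:
  assumes "extends d a"
  shows "bottom_type n (diagram_mult d a) = bottom_type n a"
proof -
  have "(\<exists>i. (i, k, u) \<in> diagram_mult d a) \<longleftrightarrow> (\<exists>j. (j, k, u) \<in> a)" for k u
    using assms by (fastforce simp: extends_def mem_diagram_mult)
  then show ?thesis by (rule bottom_type_cong)
qed

lemma alg_mult_x_elem:
  assumes d: "d \<in> diagrams n c" and a: "a \<in> diagrams n c"
  shows "alg_mult (basis_elem d) (x_elem a)
    = (if extends d a then x_elem (diagram_mult d a) else 0)"
proof (cases "extends d a")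
  case True
  \<comment> \<open>\<open>g\<close> slides the top end of an edge along \<open>d\<close>. It keeps
    the bottom vertex, hence is injective on \<open>a\<close>, so it matches the subdiagrams of
    \<open>a\<close> with those of the product and preserves their sizes.\<close>
  define g where "g = (\<lambda>(j, k, u). (THE i. (i, j, u) \<in> d, k :: nat, u :: nat))"
  have g: "g (j, k, u) = (i, k, u)" if "(i, j, u) \<in> d" for i j k u
    unfolding g_def using that diagrams_bottom[OF d] by (auto intro!: the_equality)
  have img: "diagram_mult d a' = g ` a'" if "a' \<subseteq> a" for a'
  proof (intro set_eqI iffI)
    fix x assume "x \<in> diagram_mult d a'"
    then obtain i j k u where "x = (i, k, u)" "(i, j, u) \<in> d" "(j, k, u) \<in> a'"
      by (auto simp: diagram_mult_def)
    then show "x \<in> g ` a'" using g by (metis image_eqI)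
  next
    fix x assume "x \<in> g ` a'"
    then obtain j k u where e: "(j, k, u) \<in> a'" "x = g (j, k, u)" by auto
    then obtain i where "(i, j, u) \<in> d" using True \<open>a' \<subseteq> a\<close> by (fastforce simp: extends_def)
    then show "x \<in> diagram_mult d a'" using e g by (auto simp: mem_diagram_mult)
  qed
  have inj: "inj_on g a"
    using diagrams_bottom[OF a] unfolding g_def by (auto simp: inj_on_def)
  have inj': "inj_on g a'" if "a' \<subseteq> a" for a' using inj that by (rule inj_on_subset)
  have "x_elem (diagram_mult d a)
      = (\<Sum>b\<in>(`) g ` Pow a. scale ((-1) ^ (card (g ` a) - card b)) (basis_elem b))"
    by (simp add: x_elem_def img image_Pow_surj)
  also have "\<dots> = (\<Sum>a'\<in>Pow a. scale ((-1) ^ (card (g ` a) - card (g ` a'))) (basis_elem (g ` a')))"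
    by (subst sum.reindex) (simp_all add: inj inj_on_image_Pow)
  also have "\<dots> = alg_mult (basis_elem d) (x_elem a)"
    unfolding alg_mult_basis_elem_x_elem[OF finite_diagram[OF a]]
    by (intro sum.cong refl) (simp add: img card_image inj')
  finally show ?thesis using True by simp
next
  case False
  then obtain j k u where e: "(j, k, u) \<in> a" "\<nexists>i. (i, j, u) \<in> d"
    by (auto simp: extends_def)
  \<comment> \<open>The subdiagrams of \<open>a\<close> are split by whether they contain the edge
    that \<open>d\<close> does not continue; adding it leaves the product unchanged.\<close>
  define a0 where "a0 = a - {(j, k, u)}"
  have fin: "finite a0" using finite_diagram[OF a] by (simp add: a0_def)
  have ins: "a = insert (j, k, u) a0" and nin: "(j, k, u) \<notin> a0" using e by (auto simp: a0_def)
  have same: "diagram_mult d (insert (j, k, u) a') = diagram_mult d a'" for a'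
    using e(2) by (fastforce simp: diagram_mult_def)
  let ?t = "\<lambda>a'. scale ((-1) ^ (card a - card a')) (basis_elem (diagram_mult d a'))"
  \<comment> \<open>One more edge changes the exponent by one. The bound
    \<open>card a' \<le> card a0\<close> keeps the truncated subtraction exact.\<close>
  have neg: "?t (insert (j, k, u) a') = - ?t a'" if "a' \<in> Pow a0" for a'
  proof -
    have "card a' \<le> card a0" "finite a'" "(j, k, u) \<notin> a'"
      using that fin nin by (auto intro: card_mono finite_subset)
    then show ?thesis using fin nin
      by (simp add: same ins Suc_diff_le flip: cvs.scale_minus_left)
  qed
  have "alg_mult (basis_elem d) (x_elem a) = sum ?t (Pow a0 \<union> insert (j, k, u) ` Pow a0)"
    unfolding alg_mult_basis_elem_x_elem[OF finite_diagram[OF a]]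
    using Pow_insert[of "(j, k, u)" a0] ins by simp
  also have "\<dots> = sum ?t (Pow a0) + sum ?t (insert (j, k, u) ` Pow a0)"
    using fin nin by (intro sum.union_disjoint) auto
  also have "sum ?t (insert (j, k, u) ` Pow a0) = (\<Sum>a'\<in>Pow a0. ?t (insert (j, k, u) a'))"
  proof (subst sum.reindex)
    show "inj_on (insert (j, k, u)) (Pow a0)"
      using nin by (intro inj_onI) (metis PowD insert_ident subsetD)
  qed simp
  also have "\<dots> = - sum ?t (Pow a0)"
    using neg by (simp add: sum_negf)
  finally show ?thesis using False by simp
qed

text \<open>If the product is \<open>a\<close>, an edge of \<open>a\<close> and its continuation
  share a bottom vertex in \<open>a\<close>, so the continuing edge of \<open>d\<close> is vertical.
  Conversely, a vertical edge at \<open>j\<close> is the only edge of \<open>d\<close> with bottom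
  vertex \<open>j\<close>.\<close>

lemma extends_diagram_mult_eq_iff:
  assumes d: "d \<in> diagrams n c" and a: "a \<in> diagrams n c"
  shows "extends d a \<and> diagram_mult d a = a \<longleftrightarrow> (\<forall>(j, k, u)\<in>a. (j, j, u) \<in> d)"
proof
  assume L: "extends d a \<and> diagram_mult d a = a"
  show "\<forall>(j, k, u)\<in>a. (j, j, u) \<in> d"
  proof clarify
    fix j k u assume jku: "(j, k, u) \<in> a"
    then obtain i where i: "(i, j, u) \<in> d" using L by (fastforce simp: extends_def)
    then have "(i, k, u) \<in> a" using jku L mem_diagram_mult by blast
    then show "(j, j, u) \<in> d" using i jku diagrams_bottom[OF a] by blast
  qed
next
  assume R: "\<forall>(j, k, u)\<in>a. (j, j, u) \<in> d"
  have "(i, k, u) \<in> diagram_mult d a \<longleftrightarrow> (i, k, u) \<in> a" for i k u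
    unfolding mem_diagram_mult using R diagrams_bottom[OF d] by fast
  then show "extends d a \<and> diagram_mult d a = a"
    using R by (fastforce simp: extends_def)
qed

section \<open>The trace as a count of fixed basis vectors\<close>

lemma trace_on_W:
  assumes d: "d \<in> diagrams n c"
  shows "trace_on (W n c T) (alg_mult (basis_elem d))
    = of_nat (card {a \<in> diagrams n c. bottom_type n a = T \<and> (\<forall>(j, k, u)\<in>a. (j, j, u) \<in> d)})"
proof -
  define A where "A = {a \<in> diagrams n c. bottom_type n a = T}"
  let ?f = "alg_mult (basis_elem d)" and ?B = "x_elem ` A"
  have A: "finite A" "\<And>a. a \<in> A \<Longrightarrow> finite a" "\<And>a. a \<in> A \<Longrightarrow> a \<in> diagrams n c"
    unfolding A_def using finite_diagrams finite_diagram by auto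
  have W: "W n c T = cvs.span ?B"
    unfolding W_def A_def by (rule arg_cong[of _ _ cvs.span]) auto
  have ind: "cvs.independent ?B" by (rule independent_x_elem) (use A in auto)
  have closed: "diagram_mult d a \<in> A" if "a \<in> A" "extends d a" for a
    using that diagram_mult_closed[OF d] bottom_type_diagram_mult by (auto simp: A_def)
  have f: "?f (x_elem a) = (if extends d a then x_elem (diagram_mult d a) else 0)" if "a \<in> A" for a
    using alg_mult_x_elem[OF d A(3)[OF that]] .
  have "trace_on (W n c T) ?f = (\<Sum>b\<in>?B. cvs.representation ?B (?f b) b)"
    unfolding W
  proof (rule trace_on_basis[OF ind _ linear_alg_mult_basis_elem])
    fix b assume "b \<in> ?B"
    then obtain a where a: "a \<in> A" "b = x_elem a" by blast
    show "?f b \<in> cvs.span ?B"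
    proof (cases "extends d a")
      case True
      then show ?thesis using f[OF a(1)] a closed cvs.span_base[of _ ?B] by simp
    next
      case False
      then show ?thesis using f[OF a(1)] a cvs.span_zero[of ?B] by simp
    qed
  qed (use A in simp)
  also have "\<dots> = (\<Sum>a\<in>A. cvs.representation ?B (?f (x_elem a)) (x_elem a))"
    using inj_on_x_elem[of A] A by (subst sum.reindex) auto
  \<comment> \<open>Each basis vector goes to a basis vector or to 0, so a diagonal entry is 1
    exactly when the vector is fixed; injectivity of \<open>x_elem\<close> turns this into
    \<open>diagram_mult d a = a\<close>.\<close>
  also have "\<dots> = (\<Sum>a\<in>A. if \<forall>(j, k, u)\<in>a. (j, j, u) \<in> d then 1 else 0)"
  proof (intro sum.cong refl)
    fix a assume a: "a \<in> A"
    show "cvs.representation ?B (?f (x_elem a)) (x_elem a)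
        = (if \<forall>(j, k, u)\<in>a. (j, j, u) \<in> d then 1 else 0)"
    proof (cases "extends d a")
      case True
      have "x_elem a = x_elem (diagram_mult d a) \<longleftrightarrow> diagram_mult d a = a"
        using inj_on_eq_iff[OF inj_on_x_elem[OF A(2)] a closed[OF a True]] by (auto simp only:)
      moreover have "cvs.representation ?B (x_elem (diagram_mult d a))
          = (\<lambda>v. if v = x_elem (diagram_mult d a) then 1 else 0)"
        using closed[OF a True] by (intro cvs.representation_basis ind) auto
      ultimately show ?thesis
        using True f[OF a] extends_diagram_mult_eq_iff[OF d A(3)[OF a]]
        by (simp only: if_True simp_thms)
    next
      case False
      then show ?thesis
        using f[OF a] extends_diagram_mult_eq_iff[OF d A(3)[OF a]]
        by (simp only: cvs.representation_zero if_False simp_thms)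
    qed
  qed
  also have "\<dots> = of_nat (card {a \<in> A. \<forall>(j, k, u)\<in>a. (j, j, u) \<in> d})"
    using A by (simp add: sum.If_cases Int_def)
  also have "{a \<in> A. \<forall>(j, k, u)\<in>a. (j, j, u) \<in> d}
      = {a \<in> diagrams n c. bottom_type n a = T \<and> (\<forall>(j, k, u)\<in>a. (j, j, u) \<in> d)}"
    by (auto simp: A_def)
  finally show ?thesis .
qed


section \<open>Diagrams with given bottom and top vertices\<close>

text \<open>The mirror image of \<open>bottom_type\<close> at positive indices; isolated top
  vertices are not recorded, and only the colors in \<open>{1..c}\<close> are used later.\<close>

definition top_type :: "diagram \<Rightarrow> nat \<Rightarrow> nat set" where
  "top_type a u = {j. \<exists>k. (j, k, u) \<in> a}"

lemma bottom_type_pos: "0 < u \<Longrightarrow> bottom_type n a u = {k. \<exists>j. (j, k, u) \<in> a}"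
  by (simp add: bottom_type_def)

lemma inj_on_endpoints:
  assumes "a \<in> diagrams n c"
  shows "inj_on fst a" "inj_on (\<lambda>x. fst (snd x)) a"
  using diagrams_top[OF assms] diagrams_bottom[OF assms]
  by (auto simp: inj_on_def split_paired_all)

text \<open>By planarity, the edges of color \<open>u\<close> to the left of a given one are the
  same whether compared at the top or at the bottom. So an edge joins vertices of equal rank within
  its color.\<close>

lemma card_lower_eq:
  assumes a: "a \<in> diagrams n c" and e: "(j, k, u) \<in> a"
  shows "card {j' \<in> top_type a u. j' < j} = card {k' \<in> bottom_type n a u. k' < k}"
proof -
  let ?M = "{x \<in> a. snd (snd x) = u \<and> fst x < j}"
  have u: "0 < u" using diagrams_range[OF a e] by simp
  have "{j' \<in> top_type a u. j' < j} = fst ` ?M"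
    by (force simp: top_type_def)
  moreover have "{k' \<in> bottom_type n a u. k' < k} = (\<lambda>x. fst (snd x)) ` ?M"
  proof -
    have "?M = {x \<in> a. snd (snd x) = u \<and> fst (snd x) < k}"
      using diagrams_planar[OF a _ e] by auto
    then show ?thesis by (force simp: bottom_type_pos[OF u])
  qed
  moreover have "inj_on fst ?M" "inj_on (\<lambda>x. fst (snd x)) ?M"
    using inj_on_endpoints[OF a] by (auto intro: inj_on_subset)
  ultimately show ?thesis by (simp add: card_image)
qed

text \<open>An element of a finite set of numbers is determined by its rank.\<close>

lemma card_lower_inj:
  fixes k k' :: nat
  assumes "finite T" "k \<in> T" "k' \<in> T" "card {x \<in> T. x < k} = card {x \<in> T. x < k'}"
  shows "k = k'"
proof -
  have less: "card {x \<in> T. x < k} < card {x \<in> T. x < k'}" if "k < k'" "k \<in> T" for k k'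
    using that assms(1) by (intro psubset_card_mono) auto
  show ?thesis
    using less[of k k'] less[of k' k] assms(2-4) by (cases k k' rule: linorder_cases) simp_all
qed

lemma finite_bottom_type:
  assumes "a \<in> diagrams n c"
  shows "finite (bottom_type n a u)"
  by (rule finite_subset[of _ "{1..n}"])
    (use diagrams_range[OF assms] in \<open>auto simp: bottom_type_def\<close>)

text \<open>The end of an edge is recovered by rank: the edges of \<open>a\<close> and
  \<open>b\<close> at the same top vertex \<open>j\<close> have bottom vertices of the same rank in
  the same set.\<close>

lemma diagram_subset_if_types_eq:
  assumes a: "a \<in> diagrams n c" and b: "b \<in> diagrams n c"
    and bot: "bottom_type n a = bottom_type n b"
    and top: "\<And>u. u \<in> {1..c} \<Longrightarrow> top_type a u = top_type b u"
  shows "a \<subseteq> b"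
proof clarify
  fix j k u assume e: "(j, k, u) \<in> a"
  then have u: "u \<in> {1..c}" using diagrams_range[OF a] by blast
  then obtain k' where e': "(j, k', u) \<in> b" using top e by (force simp: top_type_def)
  have "k = k'"
  proof (rule card_lower_inj[OF finite_bottom_type[OF a, of u]])
    show "k \<in> bottom_type n a u" using e u by (auto simp: bottom_type_pos)
    show "k' \<in> bottom_type n a u" using e' u bot by (auto simp: bottom_type_pos)
    show "card {x \<in> bottom_type n a u. x < k} = card {x \<in> bottom_type n a u. x < k'}"
      using card_lower_eq[OF a e] card_lower_eq[OF b e'] bot top[OF u] by simp
  qed
  then show "(j, k, u) \<in> b" using e' by simp
qed

text \<open>The entry at index 0 is the complement of the colored vertices, and entries beyond
  \<open>c\<close> are empty.\<close>

lemma bottom_type_eqI: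
  assumes a: "a \<in> diagrams n c" and b: "b \<in> diagrams n c"
    and eq: "\<And>u. u \<in> {1..c} \<Longrightarrow> bottom_type n a u = bottom_type n b u"
  shows "bottom_type n a = bottom_type n b"
proof -
  have "(\<exists>k. (k, j, u) \<in> a) \<longleftrightarrow> (\<exists>k. (k, j, u) \<in> b)" for j u
  proof (cases "u \<in> {1..c}")
    case True
    then have "j \<in> bottom_type n a u \<longleftrightarrow> j \<in> bottom_type n b u" by (simp only: eq)
    then show ?thesis using True by (simp add: bottom_type_pos)
  next
    case False
    then show ?thesis using diagrams_range[OF a] diagrams_range[OF b] by blast
  qed
  then show ?thesis by (rule bottom_type_cong)
qed

text \<open>The increasing enumeration of \<open>T\<close> is composed with the inverse of that of
  \<open>S\<close>.\<close>

lemma ex_strict_mono_bij_betw: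
  fixes S T :: "nat set"
  assumes S: "finite S" and T: "finite T" and eq: "card S = card T"
  shows "\<exists>h. bij_betw h S T \<and> strict_mono_on S h"
proof -
  obtain e where e: "bij_betw e {..<card S} S" "strict_mono_on {..<card S} e"
    using ex_bij_betw_strict_mono_card[OF S] .
  obtain e' where e': "bij_betw e' {..<card S} T" "strict_mono_on {..<card S} e'"
    using ex_bij_betw_strict_mono_card[OF T] eq by metis
  let ?r = "the_inv_into {..<card S} e"
  have r: "bij_betw ?r S {..<card S}" using e(1) by (rule bij_betw_the_inv_into)
  have "e' (?r x) < e' (?r y)" if "x \<in> S" "y \<in> S" "x < y" for x y
  proof -
    have lt: "?r x < card S" "?r y < card S"
      using r that by (auto simp: bij_betw_def)
    have "e (?r x) = x" "e (?r y) = y"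
      using e(1) that by (auto simp: bij_betw_def f_the_inv_into_f)
    then have "\<not> ?r y \<le> ?r x"
      using e(2) lt \<open>x < y\<close> by (metis lessThan_iff linorder_not_le order.strict_iff_not strict_mono_on_leD)
    then show ?thesis using e'(2) lt by (auto simp: strict_mono_on_def)
  qed
  then have "strict_mono_on S (e' \<circ> ?r)" by (simp add: strict_mono_on_def)
  then show ?thesis using bij_betw_trans[OF r e'(1)] by blast
qed

text \<open>A diagram counted here corresponds to an independent choice, for each color
  \<open>u\<close>, of \<open>card (T u)\<close> top vertices among the vertical positions of
  \<open>d\<close> of that color.\<close>

lemma card_vertical_diagrams:
  assumes d: "d \<in> diagrams n c" and T: "T \<in> bottom_types n c"
  shows "card {a \<in> diagrams n c. bottom_type n a = T \<and> (\<forall>(j, k, u)\<in>a. (j, j, u) \<in> d)}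
    = (\<Prod>u=1..c. vertical_edges d u choose card (T u))"
proof -
  \<comment> \<open>The diagram \<open>t\<close> guarantees that the sets \<open>T u\<close> are
    finite, lie in range and are disjoint for different positive colors.\<close>
  obtain t where t: "t \<in> diagrams n c" and Tt: "T = bottom_type n t"
    using T by (auto simp: bottom_types_def)
  define A where "A = {a \<in> diagrams n c. bottom_type n a = T \<and> (\<forall>(j, k, u)\<in>a. (j, j, u) \<in> d)}"
  define V where "V u = {k. (k, k, u) \<in> d}" for u
  define P where "P = (\<Pi>\<^sub>E u\<in>{1..c}. {S. S \<subseteq> V u \<and> card S = card (T u)})"
  have finV: "finite (V u)" for u
    by (rule finite_subset[of _ "{1..n}"]) (use diagrams_range[OF d] in \<open>auto simp: V_def\<close>)
  have "bij_betw (\<lambda>a. restrict (top_type a) {1..c}) A P"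
  proof (rule bij_betw_imageI[OF inj_onI subset_antisym[OF subsetI subsetI]])
    fix a b assume a: "a \<in> A" and b: "b \<in> A"
      and eq: "restrict (top_type a) {1..c} = restrict (top_type b) {1..c}"
    have "top_type a u = top_type b u" if "u \<in> {1..c}" for u
      using fun_cong[OF eq, of u] that by simp
    then show "a = b"
      using diagram_subset_if_types_eq[of a n c b] diagram_subset_if_types_eq[of b n c a] a b
      by (auto simp: A_def)
  next
    fix S assume "S \<in> (\<lambda>a. restrict (top_type a) {1..c}) ` A"
    then obtain a where a: "a \<in> A" "S = restrict (top_type a) {1..c}" by blast
    then have ad: "a \<in> diagrams n c" and aT: "bottom_type n a = T" by (auto simp: A_def)
    have "top_type a u \<subseteq> V u" for u
      using a by (fastforce simp: A_def V_def top_type_def)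
    moreover have "card (top_type a u) = card (T u)" if "u \<in> {1..c}" for u
    proof -
      let ?M = "{x \<in> a. snd (snd x) = u}"
      have "top_type a u = fst ` ?M" by (force simp: top_type_def)
      moreover have "T u = (\<lambda>x. fst (snd x)) ` ?M"
        unfolding aT[symmetric] using that by (force simp: bottom_type_pos)
      moreover have "inj_on fst ?M" "inj_on (\<lambda>x. fst (snd x)) ?M"
        using inj_on_endpoints[OF ad] by (auto intro: inj_on_subset)
      ultimately show ?thesis by (simp add: card_image)
    qed
    ultimately show "S \<in> P" using a by (auto simp: P_def)
  next
    fix S assume S: "S \<in> P"
    have "\<exists>h. bij_betw h (S u) (T u) \<and> strict_mono_on (S u) h" if "u \<in> {1..c}" for u
    proof -
      have "S u \<subseteq> V u" "card (S u) = card (T u)"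
        using S that by (auto simp: P_def PiE_iff)
      moreover from this(1) have "finite (S u)" using finV by (rule finite_subset)
      ultimately show ?thesis
        using finite_bottom_type[OF t] Tt by (intro ex_strict_mono_bij_betw) auto
    qed
    then obtain h where h: "\<And>u. u \<in> {1..c} \<Longrightarrow> bij_betw (h u) (S u) (T u)"
      "\<And>u. u \<in> {1..c} \<Longrightarrow> strict_mono_on (S u) (h u)" by metis
    \<comment> \<open>For surjectivity, the chosen top vertices \<open>S u\<close> are joined to
      \<open>T u\<close> in increasing order.\<close>
    define a where "a = {(j, h u j, u) | j u. u \<in> {1..c} \<and> j \<in> S u}"
    have mem: "(j, k, u) \<in> a \<longleftrightarrow> u \<in> {1..c} \<and> j \<in> S u \<and> k = h u j" for j k u
      by (auto simp: a_def)
    have SV: "(j, j, u) \<in> d" if "u \<in> {1..c}" "j \<in> S u" for j u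
      using S that by (force simp: P_def V_def PiE_iff)
    have hT: "h u j \<in> T u" if "u \<in> {1..c}" "j \<in> S u" for j u
      using h(1) that by (auto simp: bij_betw_def)
    have ad: "a \<in> diagrams n c"
    proof (rule diagramsI)
      fix i j u assume "(i, j, u) \<in> a"
      then have *: "u \<in> {1..c}" "i \<in> S u" "j = h u i" by (auto simp: mem)
      then obtain k where "(k, j, u) \<in> t" using hT Tt by (force simp: bottom_type_pos)
      then show "i \<in> {1..n} \<and> j \<in> {1..n} \<and> u \<in> {1..c}"
        using diagrams_range[OF t] diagrams_range[OF d] SV * by blast
    next
      fix i j u j' u' assume "(i, j, u) \<in> a" "(i, j', u') \<in> a"
      \<comment> \<open>The vertical edge of \<open>d\<close> at a top vertex has only one color, so
        the sets \<open>S u\<close> are disjoint.\<close>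
      then show "j = j' \<and> u = u'" using SV diagrams_top[OF d] by (metis mem)
    next
      fix i j u i' u' assume *: "(i, j, u) \<in> a" "(i', j, u') \<in> a"
      then have "j \<in> T u" "j \<in> T u'" "u \<in> {1..c}" "u' \<in> {1..c}"
        using hT[of u i] hT[of u' i'] by (simp_all add: mem)
      then have "u = u'" using diagrams_bottom[OF t] Tt by (fastforce simp: bottom_type_pos)
      then show "i = i' \<and> u = u'"
        using * h(1) by (auto simp: mem bij_betw_def inj_on_def)
    next
      fix i j u i' j' assume "(i, j, u) \<in> a" "(i', j', u) \<in> a" "i < i'"
      then show "j < j'" using h(2) by (auto simp: mem strict_mono_on_def)
    qed
    have "bottom_type n a u = T u" if "u \<in> {1..c}" for u
      using h(1)[OF that] that by (auto simp: bottom_type_pos mem bij_betw_def)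
    then have "bottom_type n a = T" unfolding Tt by (intro bottom_type_eqI[OF ad t]) simp
    then have "a \<in> A" using ad SV by (auto simp: A_def mem)
    moreover have "restrict (top_type a) {1..c} = S"
    proof
      fix u show "restrict (top_type a) {1..c} u = S u"
        using S by (cases "u \<in> {1..c}") (auto simp: P_def top_type_def mem)
    qed
    ultimately show "S \<in> (\<lambda>a. restrict (top_type a) {1..c}) ` A" by blast
  qed
  then have "card A = card P" by (rule bij_betw_same_card)
  also have "\<dots> = (\<Prod>u=1..c. vertical_edges d u choose card (T u))"
    unfolding P_def by (subst card_PiE) (simp_all add: n_subsets finV vertical_edges_def V_def[symmetric])
  finally show ?thesis unfolding A_def .
qed

text \<open>Ensures that the choice in \<open>W_rep\<close> has something to choose. The witness
  cuts \<open>{1..n}\<close> into consecutive blocks of lengths \<open>ns 0\<close>, ...,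
  \<open>ns c\<close>, leaves block 0 isolated and puts vertical edges of color \<open>u\<close> on
  block \<open>u\<close>.\<close>

lemma ex_bottom_type:
  assumes "(\<Sum>i=0..c. ns i) = n"
  shows "\<exists>T \<in> bottom_types n c. \<forall>i\<le>c. card (T i) = ns i"
proof -
  define s where "s i = (\<Sum>j<i. ns j)" for i
  define P where "P i = {s i<..s (Suc i)}" for i
  define a where "a = {(k, k, u) | k u. u \<in> {1..c} \<and> k \<in> P u}"
  have mono: "s i \<le> s j" if "i \<le> j" for i j
    unfolding s_def using that by (intro sum_mono2) auto
  have sn: "s (Suc c) = n" using assms by (simp add: s_def lessThan_Suc_atMost atLeast0AtMost)
  have cardP: "card (P i) = ns i" for i by (simp add: P_def s_def)
  have disj: "u = u'" if "k \<in> P u" "k \<in> P u'" for k u u'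
  proof (rule ccontr)
    assume "u \<noteq> u'"
    then consider "Suc u \<le> u'" | "Suc u' \<le> u" by linarith
    then show False
      using that mono[of "Suc u" u'] mono[of "Suc u'" u] by cases (auto simp: P_def)
  qed
  have range: "k \<in> {1..n}" if "k \<in> P u" "u \<le> c" for k u
    using that mono[of "Suc u" "Suc c"] sn by (auto simp: P_def)
  have cover: "\<exists>u\<le>c. k \<in> P u" if "k \<in> {1..n}" for k
  proof -
    \<comment> \<open>The first block whose right end reaches \<open>k\<close>; by minimality the
      preceding block ends before \<open>k\<close>.\<close>
    define u where "u = (LEAST u. k \<le> s (Suc u))"
    have "k \<le> s (Suc c)" using that sn by simp
    then have *: "k \<le> s (Suc u)" "u \<le> c"
      unfolding u_def by (auto intro: LeastI Least_le)
    have "s u < k"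
    proof (cases u)
      case 0 then show ?thesis using that by (simp add: s_def)
    next
      case (Suc v)
      then have "\<not> k \<le> s (Suc v)" using not_less_Least[of v "\<lambda>u. k \<le> s (Suc u)"] u_def by auto
      then show ?thesis using Suc by simp
    qed
    then show ?thesis using * by (auto simp: P_def)
  qed
  have ad: "a \<in> diagrams n c"
    by (rule diagramsI) (use range disj in \<open>auto simp: a_def\<close>)
  have "bottom_type n a i = P i" if "i \<le> c" for i
  proof (cases "i = 0")
    case True
    have "k \<in> P 0 \<longleftrightarrow> (\<nexists>u. u \<in> {1..c} \<and> k \<in> P u)" if "k \<in> {1..n}" for k
      using cover[OF that] disj by (metis One_nat_def Suc_leI atLeastAtMost_iff gr0I not_one_le_zero)
    moreover have "P 0 \<subseteq> {1..n}" using range[of _ 0] by blast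
    ultimately have "{k \<in> {1..n}. \<nexists>u. u \<in> {1..c} \<and> k \<in> P u} = P 0" by blast
    moreover have "(\<exists>j u. (j, k, u) \<in> a) \<longleftrightarrow> (\<exists>u. u \<in> {1..c} \<and> k \<in> P u)" for k
      by (auto simp: a_def)
    ultimately show ?thesis by (simp only: bottom_type_def True refl if_True)
  next
    case False
    then show ?thesis using that by (auto simp: bottom_type_def a_def)
  qed
  then show ?thesis
    using ad cardP by (intro bexI[of _ "bottom_type n a"]) (simp_all add: bottom_types_def)
qed

theorem theorem5p2:
  fixes c n :: nat and ns :: "nat \<Rightarrow> nat" and d :: diagram
  assumes "c \<ge> 1"
    and "(\<Sum>i=0..c. ns i) = n"
    and "d \<in> diagrams n c"
  shows "chi n c ns d =
    (if \<forall>i\<in>{1..c}. ns i \<le> vertical_edges d i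
     then of_nat (\<Prod>i=1..c. vertical_edges d i choose ns i)
     else 0)"
proof -
  \<comment> \<open>Whichever \<open>T\<close> is chosen, the count depends only on the
    cardinalities of its entries at \<open>1\<close>, ..., \<open>c\<close>.\<close>
  define T where "T = (SOME T. T \<in> bottom_types n c \<and> (\<forall>i\<le>c. card (T i) = ns i))"
  have "T \<in> bottom_types n c \<and> (\<forall>i\<le>c. card (T i) = ns i)"
    unfolding T_def using ex_bottom_type[OF assms(2)] unfolding Bex_def by (rule someI_ex)
  then have T: "T \<in> bottom_types n c" "\<forall>i\<le>c. card (T i) = ns i"
    by blast+
  have "chi n c ns d = of_nat (\<Prod>i=1..c. vertical_edges d i choose card (T i))"
    unfolding chi_def W_rep_def T_def[symmetric]
    by (simp only: trace_on_W[OF assms(3)] card_vertical_diagrams[OF assms(3) T(1)])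
  also have "(\<Prod>i=1..c. vertical_edges d i choose card (T i))
      = (\<Prod>i=1..c. vertical_edges d i choose ns i)"
    using T(2) by (intro prod.cong) auto
  finally have eq: "chi n c ns d = of_nat (\<Prod>i=1..c. vertical_edges d i choose ns i)" .
  show ?thesis
  proof (cases "\<forall>i\<in>{1..c}. ns i \<le> vertical_edges d i")
    case False
    \<comment> \<open>A single color with \<open>ns i\<close> too large contributes a vanishing
      binomial factor.\<close>
    then have "(\<Prod>i=1..c. vertical_edges d i choose ns i) = 0"
      by (auto simp: not_le binomial_eq_0 intro!: prod_zero)
    then show ?thesis using eq False by simp
  qed (use eq in simp)
qed

end
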